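(* Let $F$ be a distribution on $[0,\infty)$, let $\mu(F)=\mathbb E_{s\sim F}[s]\in[0,\infty]$ denote its mean, and let $p^*(F)$ denote its monopoly price. Then the following hold: (1) If $\mu(F)\le p^*(F)$ (with $p^*(F)<\infty$), then there exists a mechanism that is simultaneously $1$-consistent and $1$-robust for $F$. (2) If $\mu(F)=\infty$ and $p^*(F)<\infty$, then for every $\epsilon>0$ there exist $C,R\in[0,1]$ with $\min(C,R)\ge 1-\epsilon$ and a mechanism that is simultaneously $C$-consistent and $R$-robust for $F$.
   Context: A distribution $F$ on $[0,\infty)$ is a (Borel) probability distribution, with the convention $F(v)=\mathbb P[V<v]$ for $V$ distributed according to $F$. Let $\mathrm{OPT}(F)=\sup_{p\ge 0} p\,(1-F(p))$. A monopoly price $p^*(F)$ is a price attaining this supremum; $p^*(F)<\infty$ means that such a finite maximizer exists (if there are several, $p^*(F)$ is any one of them). A buyer has a value $v\in[0,\infty)$; the seller privately observes a signal $s$. In the accurate state $\mathsf A$ the value $v$ is arbitrary and $s=v$; in the hallucinatory state $\mathsf H$, $v\sim F$ and $s\sim F$ are independent. The buyer knows $v$ and the state but not $s$; the seller knows $s$ and $F$ only. A mechanism (for $F$) is an allocation rule $x(s,v,\theta)\in[0,1]$ and a payment rule $p(s,v,\theta)\in\mathbb R$, with $\theta\in\{\mathsf A,\mathsf H\}$ (measurable, and such that the expectations below are well defined), where $s$ is the seller's signal and $(v,\theta)$ the buyer's report, satisfying for all $v,v'\in[0,\infty)$: - (IC) $\mathbb E_{s\sim F}[v\,x(s,v,\mathsf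 H)-p(s,v,\mathsf H)]\ge \mathbb E_{s\sim F}[v\,x(s,v',\mathsf H)-p(s,v',\mathsf H)]$ and $v\,x(v,v,\mathsf A)-p(v,v,\mathsf A)\ge v\,x(v,v',\mathsf H)-p(v,v',\mathsf H)$; - (IR) $\mathbb E_{s\sim F}[v\,x(s,v,\mathsf H)-p(s,v,\mathsf H)]\ge 0$ and $v\,x(v,v,\mathsf A)-p(v,v,\mathsf A)\ge 0$. (No further incentive constraints are imposed; deviations in which the buyer falsely reports state $\mathsf A$, or reports $\mathsf A$ with a wrong value, are not constrained.) The mechanism is $C$-consistent if $p(v,v,\mathsf A)\ge C\,v$ for all $v\in[0,\infty)$. It is $R$-robust (for $F$) if $\mathbb E_{s\sim F,\,v\sim F}[p(s,v,\mathsf H)]\ge R\cdot \mathrm{OPT}(F)$, with $s,v$ independent. *)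

theory Defs
  imports "HOL-Probability.Probability"
begin

definition nonneg_distribution :: "real measure \<Rightarrow> bool" where
  "nonneg_distribution F \<longleftrightarrow>
     prob_space F \<and> sets F = sets borel \<and> emeasure F {..<0} = 0"

(* The distribution function uses the strict inequality, P[V < v]; the library's
   cdf uses P[V \<le> v].  Hence 1 - strict_cdf F p is the probability of a sale
   at price p when the buyer buys in case of indifference. *)
definition strict_cdf :: "real measure \<Rightarrow> real \<Rightarrow> real" where
  "strict_cdf F v = measure F {..<v}"

definition OPT :: "real measure \<Rightarrow> ereal" where
  "OPT F = (SUP p\<in>{0..}. ereal (p * (1 - strict_cdf F p)))"

(* A monopoly price need not be unique, so it is a predicate; the mathematical
   condition "p*(F) < \<infinity>" says that some real number satisfies it. *)
definition is_monopoly_price :: "real measure \<Rightarrow> real \<Rightarrow> bool" where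
  "is_monopoly_price F p \<longleftrightarrow>
     0 \<le> p \<and> ereal (p * (1 - strict_cdf F p)) = OPT F"

definition mean :: "real measure \<Rightarrow> ennreal" where
  "mean F = (\<integral>\<^sup>+ s. ennreal s \<partial>F)"

datatype state = Accurate | Hallucinatory

(* Arguments in order: the seller's signal, the reported value, the reported state.
   Signals and values live in [0,\<infinity>); the values of a rule at negative arguments
   are irrelevant to every condition below except measurability, which can always be
   met by extending a rule by zero. *)
type_synonym rule = "real \<Rightarrow> real \<Rightarrow> state \<Rightarrow> real"

(* Expectations are required to exist as finite numbers.  Integrability
   of the payment suffices because the allocation is bounded on the support of F. *)
definition well_defined_rules :: "real measure \<Rightarrow> rule \<Rightarrow> rule \<Rightarrow> bool" where
  "well_defined_rules F x p \<longleftrightarrow>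
     (\<forall>s\<ge>0. \<forall>v\<ge>0. \<forall>\<theta>. 0 \<le> x s v \<theta> \<and> x s v \<theta> \<le> 1) \<and>
     (\<forall>\<theta>. (\<lambda>(s, v). x s v \<theta>) \<in> borel_measurable (borel \<Otimes>\<^sub>M borel)) \<and>
     (\<forall>\<theta>. (\<lambda>(s, v). p s v \<theta>) \<in> borel_measurable (borel \<Otimes>\<^sub>M borel)) \<and>
     (\<forall>v\<ge>0. integrable F (\<lambda>s. p s v Hallucinatory)) \<and>
     integrable (F \<Otimes>\<^sub>M F) (\<lambda>(s, v). p s v Hallucinatory)"

definition incentive_compatible :: "real measure \<Rightarrow> rule \<Rightarrow> rule \<Rightarrow> bool" where
  "incentive_compatible F x p \<longleftrightarrow>
     (\<forall>v\<ge>0. \<forall>v'\<ge>0.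
        (\<integral>s. v * x s v Hallucinatory - p s v Hallucinatory \<partial>F)
          \<ge> (\<integral>s. v * x s v' Hallucinatory - p s v' Hallucinatory \<partial>F) \<and>
        v * x v v Accurate - p v v Accurate
          \<ge> v * x v v' Hallucinatory - p v v' Hallucinatory)"

definition individually_rational :: "real measure \<Rightarrow> rule \<Rightarrow> rule \<Rightarrow> bool" where
  "individually_rational F x p \<longleftrightarrow>
     (\<forall>v\<ge>0.
        (\<integral>s. v * x s v Hallucinatory - p s v Hallucinatory \<partial>F) \<ge> 0 \<and>
        v * x v v Accurate - p v v Accurate \<ge> 0)"

definition is_mechanism :: "real measure \<Rightarrow> rule \<Rightarrow> rule \<Rightarrow> bool" where
  "is_mechanism F x p \<longleftrightarrow>
     well_defined_rules F x p \<and> incentive_compatible F x p \<and> individually_rational F x p"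

definition consistent :: "real \<Rightarrow> rule \<Rightarrow> bool" where
  "consistent C p \<longleftrightarrow> (\<forall>v\<ge>0. p v v Accurate \<ge> C * v)"

definition robust :: "real measure \<Rightarrow> real \<Rightarrow> rule \<Rightarrow> bool" where
  "robust F R p \<longleftrightarrow>
     ereal (\<integral>(s, v). p s v Hallucinatory \<partial>(F \<Otimes>\<^sub>M F)) \<ge> ereal R * OPT F"

end

(* Both parts use the following mechanism. In the accurate state the good is sold at price C * v.
   In the hallucinatory state a report v' below the monopoly price pstar gets nothing, and a report
   v' \<ge> pstar gets the allocation a s and pays l s, where l has mean pstar * E[a], so that on
   average the buyer faces the price pstar. A buyer in the accurate state does not gain from
   reporting the other state as soon as l s \<ge> s * (a s - (1 - C)).

   If the mean mu is at most pstar, take C = 1, a = 1 and l s = s + (pstar - mu).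
   If the mean is infinite, take C = 1 - \<epsilon> and let a be the indicator of [0, T], with T so large
   that E[a] \<ge> 1 - \<epsilon>. For a signal above T the seller may pay the buyer up to \<epsilon> * s; these
   payments have infinite mean, so they compensate the payments collected below T. *)
theory Submission imports Defs begin

lemma nonneg_distribution_AE_nonneg:
  assumes "nonneg_distribution F"
  shows "AE s in F. 0 \<le> s"
  using assms by (intro AE_I' [of "{..<0}"]) (auto simp: nonneg_distribution_def null_sets_def)

text \<open>By \<open>l_mean\<close>, a value \<open>v\<close> expects
  \<open>q * (v - pstar)\<close> from reporting a value of at least \<open>pstar\<close> in the
  hallucinatory state, where \<open>q\<close> is the mean of \<open>a\<close>. The revenue is
  therefore \<open>q\<close> times the monopoly revenue, which gives robustness \<open>q\<close>.
  \<open>l_ge\<close> is what rules out gains in the accurate state.\<close>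

lemma posted_price_mechanism:
  fixes F :: "real measure" and a l :: "real \<Rightarrow> real"
  assumes F: "nonneg_distribution F"
    and price: "is_monopoly_price F pstar"
    and a_meas: "a \<in> borel_measurable borel"
    and a_bounds: "\<And>s. 0 \<le> s \<Longrightarrow> 0 \<le> a s \<and> a s \<le> 1"
    and a_int: "integrable F a"
    and l_meas: "l \<in> borel_measurable borel"
    and l_int: "integrable F l"
    and l_ge: "\<And>s. 0 \<le> s \<Longrightarrow> s * (a s - (1 - C)) \<le> l s"
    and l_mean: "(\<integral>s. l s \<partial>F) = pstar * (\<integral>s. a s \<partial>F)"
    and C: "C \<le> 1" and R: "R \<le> (\<integral>s. a s \<partial>F)"
  shows "\<exists>x p. is_mechanism F x p \<and> consistent C p \<and> robust F R p"
proof -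
  interpret prob_space F
    using F by (simp add: nonneg_distribution_def)
  interpret FF: pair_prob_space F F ..
  have sets_F [measurable_cong]: "sets F = sets borel"
    using F by (simp add: nonneg_distribution_def)
  then have space_F: "space F = UNIV"
    by (metis sets_eq_imp_space_eq space_borel)
  note [measurable] = a_meas l_meas
  define x :: rule where
    "x = (\<lambda>s v \<theta>. case \<theta> of Accurate \<Rightarrow> 1 | Hallucinatory \<Rightarrow> if pstar \<le> v then a s else 0)"
  define p :: rule where
    "p = (\<lambda>s v \<theta>. case \<theta> of Accurate \<Rightarrow> C * v | Hallucinatory \<Rightarrow> if pstar \<le> v then l s else 0)"
  \<comment> \<open>A monopoly price makes \<open>OPT F\<close> a real number, so robustness becomes
    an inequality between reals.\<close>
  have pstar: "0 \<le> pstar" and opt: "OPT F = ereal (pstar * (1 - strict_cdf F pstar))"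
    using price by (auto simp: is_monopoly_price_def)
  define q where "q = (\<integral>s. a s \<partial>F)"
  \<comment> \<open>In product form the payment separates signal from report, so the double integral
    factorizes.\<close>
  have p_H: "p s v Hallucinatory = l s * indicator {pstar..} v" for s v
    by (simp add: p_def indicator_def)
  have pair_int: "integrable (F \<Otimes>\<^sub>M F) (\<lambda>(s, v). p s v Hallucinatory)"
  proof (rule FF.Fubini_integrable)
    show "(\<lambda>(s, v). p s v Hallucinatory) \<in> borel_measurable (F \<Otimes>\<^sub>M F)"
      unfolding p_def by simp
    have "(\<lambda>s. \<integral>v. norm (p s v Hallucinatory) \<partial>F)
        = (\<lambda>s. \<integral>v. \<bar>l s\<bar> * indicator {pstar..} v \<partial>F)"
      by (simp add: p_H abs_mult)
    then show "integrable F (\<lambda>s. \<integral>v. norm (case (s, v) of (s, v) \<Rightarrow> p s v Hallucinatory) \<partial>F)"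
      using l_int by simp
    show "AE s in F. integrable F (\<lambda>v. case (s, v) of (s, v) \<Rightarrow> p s v Hallucinatory)"
      by (intro AE_I2 integrable_const_bound [where B="\<bar>l s\<bar>" for s])
        (auto simp: p_def)
  qed
  \<comment> \<open>The strict inequality in \<open>strict_cdf\<close> matches a sale at equality:
    the complement is the closed half-line on which \<open>p\<close> charges.\<close>
  have sale: "measure F {pstar..} = 1 - strict_cdf F pstar"
    using prob_compl [of "{..<pstar}"]
    by (simp add: strict_cdf_def space_F sets_F Compl_eq_Diff_UNIV [symmetric])
  have "(\<integral>(s, v). p s v Hallucinatory \<partial>(F \<Otimes>\<^sub>M F)) = (\<integral>s. \<integral>v. p s v Hallucinatory \<partial>F \<partial>F)"
    using FF.integral_fst' [OF pair_int] by simp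
  also have "\<dots> = (\<integral>s. \<integral>v. l s * indicator {pstar..} v \<partial>F \<partial>F)"
    by (simp add: p_H)
  also have "\<dots> = q * (pstar * (1 - strict_cdf F pstar))"
    by (simp add: l_mean q_def sale space_F)
  finally have revenue:
    "(\<integral>(s, v). p s v Hallucinatory \<partial>(F \<Otimes>\<^sub>M F)) = q * (pstar * (1 - strict_cdf F pstar))" .
  have "0 \<le> pstar * (1 - strict_cdf F pstar)"
    using pstar by (simp add: strict_cdf_def)
  then have "robust F R p"
    using R unfolding robust_def revenue opt
    by (simp add: q_def mult_right_mono del: mult_le_cancel_right)
  moreover have "consistent C p"
    by (simp add: consistent_def p_def)
  moreover have "is_mechanism F x p"
  proof -
    \<comment> \<open>The report \<open>v'\<close> matters only through its side of
      \<open>pstar\<close>, and the sign of \<open>v - pstar\<close> decides which side is best;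
      truth picks it.\<close>
    have util: "(\<integral>s. v * x s v' Hallucinatory - p s v' Hallucinatory \<partial>F)
        = (if pstar \<le> v' then q * (v - pstar) else 0)" for v v'
      using a_int l_int by (simp add: x_def p_def l_mean q_def algebra_simps)
    have a_nonneg: "AE s in F. 0 \<le> a s"
      using nonneg_distribution_AE_nonneg [OF F] by eventually_elim (simp add: a_bounds)
    then have "0 \<le> q"
      unfolding q_def by (rule integral_nonneg_AE)
    have "well_defined_rules F x p"
      unfolding well_defined_rules_def
    proof (intro conjI allI impI)
      fix \<theta>
      show "(\<lambda>(s, v). x s v \<theta>) \<in> borel_measurable (borel \<Otimes>\<^sub>M borel)"
        by (cases \<theta>) (simp_all add: x_def)
      show "(\<lambda>(s, v). p s v \<theta>) \<in> borel_measurable (borel \<Otimes>\<^sub>M borel)"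
        by (cases \<theta>) (simp_all add: p_def)
    next
      fix s v :: real and \<theta>
      assume "0 \<le> s"
      then show "0 \<le> x s v \<theta>" "x s v \<theta> \<le> 1"
        using a_bounds by (cases \<theta>; simp add: x_def)+
    next
      show "integrable F (\<lambda>s. p s v Hallucinatory)" for v
        using l_int by (simp add: p_H)
    qed (rule pair_int)
    moreover have "incentive_compatible F x p"
      unfolding incentive_compatible_def util
    proof (intro allI impI conjI)
      fix v v' :: real
      assume "0 \<le> v" "0 \<le> v'"
      show "(if pstar \<le> v' then q * (v - pstar) else 0)
          \<le> (if pstar \<le> v then q * (v - pstar) else 0)"
        using \<open>0 \<le> q\<close> by (simp add: mult_nonneg_nonpos)
      \<comment> \<open>In the accurate state the signal is \<open>v\<close> itself. If
        \<open>pstar \<le> v'\<close>, the claim is \<open>l_ge\<close> at \<open>s = v\<close>;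
        otherwise the deviation yields 0 and \<open>C \<le> 1\<close> suffices.\<close>
      show "v * x v v' Hallucinatory - p v v' Hallucinatory \<le> v * x v v Accurate - p v v Accurate"
        using l_ge [OF \<open>0 \<le> v\<close>] C \<open>0 \<le> v\<close> mult_right_mono [of C 1 v]
        by (simp add: x_def p_def algebra_simps)
    qed
    moreover have "individually_rational F x p"
      unfolding individually_rational_def util
      using \<open>0 \<le> q\<close> C mult_right_mono [of C 1] by (simp add: x_def p_def)
    ultimately show ?thesis
      by (simp add: is_mechanism_def)
  qed
  ultimately show ?thesis
    by blast
qed

text \<open>By monotone convergence, a common bound on the truncated means would bound the mean
  itself.\<close>

lemma truncated_mean_unbounded:
  assumes F: "nonneg_distribution F" and mean: "mean F = \<infinity>"
  shows "\<exists>n::nat. b < (\<integral>s. s * indicator {0..real n} s \<partial>F)"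
proof (rule ccontr)
  interpret prob_space F
    using F by (simp add: nonneg_distribution_def)
  have sets_F [measurable_cong]: "sets F = sets borel"
    using F by (simp add: nonneg_distribution_def)
  assume "\<not> ?thesis"
  then have le: "(\<integral>s. s * indicator {0..real n} s \<partial>F) \<le> b" for n
    by (simp add: not_less)
  have "mean F = (\<integral>\<^sup>+s. (SUP n. ennreal (s * indicator {0..real n} s)) \<partial>F)"
    unfolding mean_def
  proof (rule nn_integral_cong)
    fix s :: real
    obtain m :: nat where m: "s \<le> real m"
      using real_arch_simple by blast
    have "ennreal (s * indicator {0..real n} s) \<le> ennreal s" for n
      by (auto simp: indicator_def)
    \<comment> \<open>The supremum is attained once the cutoff exceeds \<open>s\<close>; for
      negative \<open>s\<close> both sides are 0, since \<open>ennreal\<close> cuts off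
      there.\<close>
    moreover have "ennreal s \<le> ennreal (s * indicator {0..real m} s)"
      using m by (auto simp: indicator_def ennreal_neg)
    ultimately show "ennreal s = (SUP n. ennreal (s * indicator {0..real n} s))"
      by (intro antisym SUP_least) (auto intro: SUP_upper2)
  qed
  also have "\<dots> = (SUP n. \<integral>\<^sup>+s. ennreal (s * indicator {0..real n} s) \<partial>F)"
    by (rule nn_integral_monotone_convergence_SUP)
      (auto simp: incseq_def le_fun_def indicator_def intro!: ennreal_leI)
  also have "\<dots> \<le> ennreal b"
  proof (rule SUP_least)
    fix n :: nat
    have "integrable F (\<lambda>s. s * indicator {0..real n} s)"
      by (rule integrable_const_bound [where B="real n"]) (auto simp: indicator_def)
    then have "(\<integral>\<^sup>+s. ennreal (s * indicator {0..real n} s) \<partial>F)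
        = ennreal (\<integral>s. s * indicator {0..real n} s \<partial>F)"
      by (rule nn_integral_eq_integral) (auto simp: indicator_def)
    then show "(\<integral>\<^sup>+s. ennreal (s * indicator {0..real n} s) \<partial>F) \<le> ennreal b"
      using le by (simp add: ennreal_leI)
  qed
  finally show False
    using mean by (simp add: top_unique)
qed

text \<open>Continuity from below along intervals exhausting the half-line that carries all the
  mass.\<close>

lemma truncated_mass_near_one:
  assumes F: "nonneg_distribution F" and "0 < (e::real)"
  shows "\<exists>n::nat. 1 - e < measure F {0..real n}"
proof -
  interpret prob_space F
    using F by (simp add: nonneg_distribution_def)
  have sets_F: "sets F = sets borel"
    using F by (simp add: nonneg_distribution_def)
  then have space_F: "space F = UNIV"
    by (metis sets_eq_imp_space_eq space_borel)
  have "(\<lambda>n. measure F {0..real n}) \<longlonglongrightarrow> measure F (\<Union>n. {0..real n})"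
    by (rule finite_Lim_measure_incseq) (auto simp: sets_F incseq_def)
  moreover have "(\<Union>n. {0..real n}) = {0..}"
    by (auto intro: real_arch_simple)
  moreover have "measure F {0..} = 1"
    using F prob_compl [of "{..<0}"]
    by (simp add: nonneg_distribution_def space_F sets_F measure_def
        Compl_eq_Diff_UNIV [symmetric])
  ultimately have "(\<lambda>n. measure F {0..real n}) \<longlonglongrightarrow> 1"
    by simp
  from order_tendstoD(1) [OF this, of "1 - e"] \<open>0 < e\<close> show ?thesis
    by (auto simp: eventually_sequentially)
qed

text \<open>For \<open>C = 1\<close> and \<open>a = 1\<close>, \<open>l_ge\<close> reads
  \<open>s \<le> l s\<close>, so \<open>l\<close> has mean at least that of \<open>F\<close>. The
  assumption on the mean leaves room to raise it to \<open>pstar\<close> by a nonnegative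
  constant.\<close>

lemma mechanism_of_mean_le_price:
  assumes F: "nonneg_distribution F" and price: "is_monopoly_price F pstar"
    and mean: "mean F \<le> ennreal pstar"
  shows "\<exists>x p. is_mechanism F x p \<and> consistent 1 p \<and> robust F 1 p"
proof -
  interpret prob_space F
    using F by (simp add: nonneg_distribution_def)
  have sets_F [measurable_cong]: "sets F = sets borel"
    using F by (simp add: nonneg_distribution_def)
  have pstar: "0 \<le> pstar"
    using price by (simp add: is_monopoly_price_def)
  note nonneg = nonneg_distribution_AE_nonneg [OF F]
  have int: "integrable F (\<lambda>s. s)"
    using nonneg mean
    by (auto intro!: integrableI_nonneg simp: mean_def intro: le_less_trans)
  then have "ennreal (\<integral>s. s \<partial>F) = mean F"
    unfolding mean_def using nonneg by (simp add: nn_integral_eq_integral)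
  with mean have "ennreal (\<integral>s. s \<partial>F) \<le> ennreal pstar"
    by (simp only:)
  then have mu: "(\<integral>s. s \<partial>F) \<le> pstar"
    using pstar by (simp add: ennreal_le_iff)
  define c where "c = pstar - (\<integral>s. s \<partial>F)"
  have "0 \<le> c"
    using mu by (simp add: c_def)
  show ?thesis
  proof (rule posted_price_mechanism [OF F price, where a="\<lambda>_. 1" and l="\<lambda>s. s + c"])
    show "integrable F (\<lambda>s. s + c)"
      using int by simp
    show "(\<integral>s. s + c \<partial>F) = pstar * (\<integral>s. 1 \<partial>F)"
      using int by (simp add: prob_space) (simp add: c_def)
  qed (use \<open>0 \<le> c\<close> in \<open>simp_all add: prob_space\<close>)
qed

text \<open>The rebate \<open>e * s\<close> is cut off at a level \<open>M\<close> to keep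
  \<open>l\<close> integrable. \<open>T\<close> controls the probability of allocation,
  \<open>M\<close> the mean of the rebate.\<close>

lemma mechanism_of_infinite_mean:
  assumes F: "nonneg_distribution F" and price: "is_monopoly_price F pstar"
    and mean: "mean F = \<infinity>" and e: "0 < (e::real)"
  shows "\<exists>x p. is_mechanism F x p \<and> consistent (1 - e) p \<and> robust F (1 - e) p"
proof -
  interpret prob_space F
    using F by (simp add: nonneg_distribution_def)
  have sets_F [measurable_cong]: "sets F = sets borel"
    using F by (simp add: nonneg_distribution_def)
  obtain T :: nat where T: "1 - e < measure F {0..real T}"
    using truncated_mass_near_one [OF F e] by blast
  define m where "m n = (\<integral>s. s * indicator {0..real n} s \<partial>F)" for n :: nat
  define q where "q = measure F {0..real T}"
  \<comment> \<open>This threshold makes the mean charge net of rebates,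
    \<open>m T - e * m M\<close>, at most the target \<open>pstar * q\<close>.\<close>
  obtain M :: nat where "(m T - pstar * q) / e < m M"
    using truncated_mean_unbounded [OF F mean] unfolding m_def by blast
  then have M: "m T - e * m M \<le> pstar * q"
    using e by (simp add: field_simps)
  \<comment> \<open>The remaining gap is charged as a flat fee; it is nonnegative by
    \<open>M\<close>, so it cannot break \<open>l_ge\<close>.\<close>
  define c where "c = pstar * q - (m T - e * m M)"
  define l where
    "l s = s * indicator {0..real T} s - e * (s * indicator {0..real M} s) + c" for s :: real
  have int: "integrable F (\<lambda>s. s * indicator {0..real n} s)" for n
    by (rule integrable_const_bound [where B="real n"]) (auto simp: indicator_def)
  have ind: "integrable F (indicator {0..real T} :: real \<Rightarrow> real)"
    by (rule integrable_const_bound [where B=1]) (auto simp: indicator_def)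
  have q: "(\<integral>s. indicator {0..real T} s \<partial>F) = q"
    using sets_eq_imp_space_eq [OF sets_F] by (simp add: q_def)
  show ?thesis
  proof (rule posted_price_mechanism [OF F price, where a="indicator {0..real T}" and l=l])
    show "integrable F l"
      unfolding l_def using int by simp
    show "(\<integral>s. l s \<partial>F) = pstar * (\<integral>s. indicator {0..real T} s \<partial>F)"
      unfolding l_def q using int by (simp add: m_def [symmetric] c_def prob_space)
    fix s :: real
    assume "0 \<le> s"
    \<comment> \<open>Cutting off the rebate only lowers it, so \<open>l s\<close> stays above
      \<open>s * a s - e * s\<close>, the bound in \<open>l_ge\<close> for
      \<open>C = 1 - e\<close>.\<close>
    then have "e * (s * indicator {0..real M} s) \<le> e * s"
      using e by (simp add: indicator_def)
    then show "s * (indicator {0..real T} s - (1 - (1 - e))) \<le> l s"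
      using M by (simp add: l_def c_def algebra_simps)
  qed (use T e ind q in \<open>auto simp: q_def l_def [abs_def] indicator_def\<close>)
qed

theorem theorem1p3:
  fixes F :: "real measure"
  assumes "nonneg_distribution F"
  shows
    "(\<forall>pstar. is_monopoly_price F pstar \<and> mean F \<le> ennreal pstar \<longrightarrow>
        (\<exists>x p. is_mechanism F x p \<and> consistent 1 p \<and> robust F 1 p)) \<and>
     (mean F = \<infinity> \<and> (\<exists>pstar. is_monopoly_price F pstar) \<longrightarrow>
        (\<forall>\<epsilon>::real. \<epsilon> > 0 \<longrightarrow>
           (\<exists>C R. C \<in> {0..1} \<and> R \<in> {0..1} \<and> min C R \<ge> 1 - \<epsilon> \<and>
              (\<exists>x p. is_mechanism F x p \<and> consistent C p \<and> robust F R p))))"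
proof (intro conjI allI impI)
  fix pstar
  assume "is_monopoly_price F pstar \<and> mean F \<le> ennreal pstar"
  then show "\<exists>x p. is_mechanism F x p \<and> consistent 1 p \<and> robust F 1 p"
    using mechanism_of_mean_le_price [OF assms] by blast
next
  fix \<epsilon> :: real
  assume F: "mean F = \<infinity> \<and> (\<exists>pstar. is_monopoly_price F pstar)" and "\<epsilon> > 0"
  \<comment> \<open>Capping at 1 keeps \<open>1 - e\<close> in the unit interval when
    \<open>\<epsilon>\<close> is large.\<close>
  define e where "e = min \<epsilon> 1"
  have "\<exists>x p. is_mechanism F x p \<and> consistent (1 - e) p \<and> robust F (1 - e) p"
    using F \<open>\<epsilon> > 0\<close> mechanism_of_infinite_mean [OF assms] by (auto simp: e_def)
  moreover have "1 - e \<in> {0..1}" "min (1 - e) (1 - e) \<ge> 1 - \<epsilon>"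
    using \<open>\<epsilon> > 0\<close> by (auto simp: e_def)
  ultimately show "\<exists>C R. C \<in> {0..1} \<and> R \<in> {0..1} \<and> min C R \<ge> 1 - \<epsilon> \<and>
              (\<exists>x p. is_mechanism F x p \<and> consistent C p \<and> robust F R p)"
    by blast
qed

end
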